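(* Let $P_1,\dots,P_6$ be the parameter spaces and, for $c_i\in P_i$, let $\mathfrak g_i(c_i)$ be the $4$-dimensional real Lie algebra of Type $i$ with parameters $c_i$ (all as defined in the context). Then the six types are mutually non-isomorphic for generic values of the parameters: there is a nonempty Zariski-open subset $W\subset P_1\times P_2\times P_3\times P_4\times P_5\times P_6$ such that for every $(c_1,\dots,c_6)\in W$ and all $1\le i<j\le 6$, the Lie algebras $\mathfrak g_i(c_i)$ and $\mathfrak g_j(c_j)$ are not isomorphic.
   Context: All Lie algebras are over $\mathbb R$. Each of the following six families consists of Lie algebras with basis $y_1,y_2,y_3,y_4$ and $[y_1,y_2]=y_3$, $[y_1,y_3]=y_4$; the remaining brackets are listed below (extended by bilinearity and antisymmetry). They are the six families of solutions of the Jacobi identities obtained for the general $4$-dimensional bracket satisfying these two normalizations (Engel-like Lie algebras). The symbols $C_{i,j,k}$ that appear are real parameters, chosen independently for the different types. Type 1. Parameters $(C_{1,4,3},C_{1,4,4},C_{2,3,4},C_{2,4,4})\in P_1=\mathbb R^4$: $[y_1,y_4]=C_{1,4,3}y_3+C_{1,4,4}y_4$; $[y_2,y_3]=(-C_{1,4,4}C_{2,3,4}+C_{2,4,4})y_3+C_{2,3,4}y_4$; $[y_2,y_4]=C_{1,4,3}C_{2,3,4}y_3+C_{2,4,4}y_4$; $[y_3,y_4]=0$. Type 2. Parameters $(C_{1,4,3},C_{1,4,4},C_{2,3,4},C_{2,4,4})\in P_2=\{C_{1,4,4}\neq0\}\subset\mathbb R^4$. Write $a=C_{1,4,4}$, $b=C_{1,4,3}$,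 $s=C_{2,3,4}$, $t=C_{2,4,4}$, $E=a^2+4b$: $[y_1,y_4]=\frac{E}{8}\bigl(-(as-2t)y_1-a y_2\bigr)+b y_3+a y_4$; $[y_2,y_3]=\frac{E(as-t)}{2a^2}\bigl(-(as-2t)y_1-a y_2\bigr)+(-as+t)y_3+s y_4$; $[y_2,y_4]=-\frac18(as-2t)E s\,y_1-\frac18 E a s\,y_2-\frac{1}{2a}\bigl(a^3s+2abs-a^2t-4bt\bigr)y_3+t y_4$; $[y_3,y_4]=\frac{E(as-t)}{8a^2}\bigl((as-2t)E\,y_1+aE\,y_2+2a^2y_3-4a\,y_4\bigr)$. Type 3. Parameters $(C_{1,4,2},C_{1,4,3},C_{1,4,4},C_{2,4,4})\in P_3=\{C_{1,4,4}\ne0\}\subset\mathbb R^4$: $[y_1,y_4]=-\frac{C_{1,4,2}C_{2,4,4}}{C_{1,4,4}}y_1+C_{1,4,2}y_2+C_{1,4,3}y_3+C_{1,4,4}y_4$; $[y_2,y_3]=\frac{C_{2,4,4}}{C_{1,4,4}}y_4$; $[y_2,y_4]=\frac{C_{2,4,4}}{C_{1,4,4}^2}\bigl(-C_{1,4,2}C_{2,4,4}y_1+C_{1,4,2}C_{1,4,4}y_2+C_{1,4,3}C_{1,4,4}y_3+C_{1,4,4}^2y_4\bigr)$; $[y_3,y_4]=0$. Type 4. Parameters $(C_{2,3,1},C_{2,3,4},C_{2,4,4})\in P_4=\mathbb R^3$: $[y_1,y_4]=0$; $[y_2,y_3]=C_{2,3,1}y_1+C_{2,4,4}y_3+C_{2,3,4}y_4$;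 $[y_2,y_4]=C_{2,4,4}y_4$; $[y_3,y_4]=0$. Type 5. Parameters $(C_{1,4,2},C_{1,4,3},C_{2,3,4})\in P_5=\mathbb R^3$: $[y_1,y_4]=-C_{1,4,2}C_{2,3,4}y_1+C_{1,4,2}y_2+C_{1,4,3}y_3$; $[y_2,y_3]=C_{2,3,4}y_4$; $[y_2,y_4]=-C_{1,4,2}C_{2,3,4}^2y_1+C_{1,4,2}C_{2,3,4}y_2+C_{1,4,3}C_{2,3,4}y_3$; $[y_3,y_4]=0$. Type 6. Parameters $(C_{1,4,3},C_{2,3,1},C_{2,3,4},C_{3,4,4})\in P_6=\mathbb R^4$: $[y_1,y_4]=C_{1,4,3}y_3$; $[y_2,y_3]=C_{2,3,1}y_1+C_{3,4,4}y_2+C_{2,3,4}y_4$; $[y_2,y_4]=(C_{1,4,3}C_{2,3,4}+C_{3,4,4})y_3$; $[y_3,y_4]=-C_{1,4,3}C_{2,3,1}y_1-C_{1,4,3}C_{3,4,4}y_2+C_{3,4,4}y_4$. Here a Zariski-open subset of a product of the $P_i$ means the set of points of the product at which at least one of finitely many given real polynomials in all the parameters is nonzero. *)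

theory Defs
  imports "HOL-Analysis.Analysis"
begin

definition lie_algebra :: "('a::real_vector \<Rightarrow> 'a \<Rightarrow> 'a) \<Rightarrow> bool" where
  "lie_algebra B \<longleftrightarrow>
     (\<forall>x. linear (\<lambda>z. B x z)) \<and> (\<forall>z. linear (\<lambda>x. B x z)) \<and>
     (\<forall>x. B x x = 0) \<and>
     (\<forall>x z w. B x (B z w) + B z (B w x) + B w (B x z) = 0)"

definition lie_isomorphic ::
  "('a::real_vector \<Rightarrow> 'a \<Rightarrow> 'a) \<Rightarrow> ('b::real_vector \<Rightarrow> 'b \<Rightarrow> 'b) \<Rightarrow> bool" where
  "lie_isomorphic B B' \<longleftrightarrow>
     (\<exists>f. linear f \<and> bij f \<and> (\<forall>x z. f (B x z) = B' (f x) (f z)))"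

abbreviation ybas :: "4 \<Rightarrow> real^4" where
  "ybas i \<equiv> axis i 1"

text \<open>The alternating bilinear extension of \<open>[y1,y2] = y3\<close>, \<open>[y1,y3] = y4\<close>,
  \<open>[y1,y4] = b14\<close>, \<open>[y2,y3] = b23\<close>, \<open>[y2,y4] = b24\<close>, \<open>[y3,y4] = b34\<close>.\<close>

definition engel_bracket ::
  "real^4 \<Rightarrow> real^4 \<Rightarrow> real^4 \<Rightarrow> real^4 \<Rightarrow> real^4 \<Rightarrow> real^4 \<Rightarrow> real^4" where
  "engel_bracket b14 b23 b24 b34 x z =
     (x$1 * z$2 - x$2 * z$1) *\<^sub>R ybas 3 + (x$1 * z$3 - x$3 * z$1) *\<^sub>R ybas 4 +
     (x$1 * z$4 - x$4 * z$1) *\<^sub>R b14 + (x$2 * z$3 - x$3 * z$2) *\<^sub>R b23 +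
     (x$2 * z$4 - x$4 * z$2) *\<^sub>R b24 + (x$3 * z$4 - x$4 * z$3) *\<^sub>R b34"

type_synonym real3 = "real \<times> real \<times> real"
type_synonym real4 = "real \<times> real \<times> real \<times> real"

definition P1 :: "real4 set" where "P1 = UNIV"
definition P2 :: "real4 set" where "P2 = {(C143, C144, C234, C244). C144 \<noteq> 0}"
definition P3 :: "real4 set" where "P3 = {(C142, C143, C144, C244). C144 \<noteq> 0}"
definition P4 :: "real3 set" where "P4 = UNIV"
definition P5 :: "real3 set" where "P5 = UNIV"
definition P6 :: "real4 set" where "P6 = UNIV"

definition g1 :: "real4 \<Rightarrow> real^4 \<Rightarrow> real^4 \<Rightarrow> real^4" where
  "g1 = (\<lambda>(C143, C144, C234, C244). engel_bracket
     (C143 *\<^sub>R ybas 3 + C144 *\<^sub>R ybas 4)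
     ((- C144 * C234 + C244) *\<^sub>R ybas 3 + C234 *\<^sub>R ybas 4)
     ((C143 * C234) *\<^sub>R ybas 3 + C244 *\<^sub>R ybas 4)
     0)"

text \<open>Below, \<open>b\<close>, \<open>a\<close>, \<open>s\<close>, \<open>t\<close> stand for \<open>C143\<close>, \<open>C144\<close>, \<open>C234\<close>, \<open>C244\<close>.\<close>

definition g2 :: "real4 \<Rightarrow> real^4 \<Rightarrow> real^4 \<Rightarrow> real^4" where
  "g2 = (\<lambda>(b, a, s, t). let E = a\<^sup>2 + 4 * b in engel_bracket
     ((E / 8) *\<^sub>R (- (a * s - 2 * t) *\<^sub>R ybas 1 - a *\<^sub>R ybas 2) + b *\<^sub>R ybas 3 + a *\<^sub>R ybas 4)
     ((E * (a * s - t) / (2 * a\<^sup>2)) *\<^sub>R (- (a * s - 2 * t) *\<^sub>R ybas 1 - a *\<^sub>R ybas 2)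
        + (- a * s + t) *\<^sub>R ybas 3 + s *\<^sub>R ybas 4)
     (- ((1 / 8) * (a * s - 2 * t) * E * s) *\<^sub>R ybas 1 - ((1 / 8) * E * a * s) *\<^sub>R ybas 2
        - ((1 / (2 * a)) * (a^3 * s + 2 * a * b * s - a\<^sup>2 * t - 4 * b * t)) *\<^sub>R ybas 3 + t *\<^sub>R ybas 4)
     ((E * (a * s - t) / (8 * a\<^sup>2)) *\<^sub>R
        (((a * s - 2 * t) * E) *\<^sub>R ybas 1 + (a * E) *\<^sub>R ybas 2 + (2 * a\<^sup>2) *\<^sub>R ybas 3 - (4 * a) *\<^sub>R ybas 4)))"

definition g3 :: "real4 \<Rightarrow> real^4 \<Rightarrow> real^4 \<Rightarrow> real^4" where
  "g3 = (\<lambda>(C142, C143, C144, C244). engel_bracket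
     (- (C142 * C244 / C144) *\<^sub>R ybas 1 + C142 *\<^sub>R ybas 2 + C143 *\<^sub>R ybas 3 + C144 *\<^sub>R ybas 4)
     ((C244 / C144) *\<^sub>R ybas 4)
     ((C244 / C144\<^sup>2) *\<^sub>R
        (- (C142 * C244) *\<^sub>R ybas 1 + (C142 * C144) *\<^sub>R ybas 2 + (C143 * C144) *\<^sub>R ybas 3 + C144\<^sup>2 *\<^sub>R ybas 4))
     0)"

definition g4 :: "real3 \<Rightarrow> real^4 \<Rightarrow> real^4 \<Rightarrow> real^4" where
  "g4 = (\<lambda>(C231, C234, C244). engel_bracket
     0
     (C231 *\<^sub>R ybas 1 + C244 *\<^sub>R ybas 3 + C234 *\<^sub>R ybas 4)
     (C244 *\<^sub>R ybas 4)
     0)"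

definition g5 :: "real3 \<Rightarrow> real^4 \<Rightarrow> real^4 \<Rightarrow> real^4" where
  "g5 = (\<lambda>(C142, C143, C234). engel_bracket
     (- (C142 * C234) *\<^sub>R ybas 1 + C142 *\<^sub>R ybas 2 + C143 *\<^sub>R ybas 3)
     (C234 *\<^sub>R ybas 4)
     (- (C142 * C234\<^sup>2) *\<^sub>R ybas 1 + (C142 * C234) *\<^sub>R ybas 2 + (C143 * C234) *\<^sub>R ybas 3)
     0)"

definition g6 :: "real4 \<Rightarrow> real^4 \<Rightarrow> real^4 \<Rightarrow> real^4" where
  "g6 = (\<lambda>(C143, C231, C234, C344). engel_bracket
     (C143 *\<^sub>R ybas 3)
     (C231 *\<^sub>R ybas 1 + C344 *\<^sub>R ybas 2 + C234 *\<^sub>R ybas 4)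
     ((C143 * C234 + C344) *\<^sub>R ybas 3)
     (- (C143 * C231) *\<^sub>R ybas 1 - (C143 * C344) *\<^sub>R ybas 2 + C344 *\<^sub>R ybas 4))"

definition gfam ::
  "real4 \<times> real4 \<times> real4 \<times> real3 \<times> real3 \<times> real4 \<Rightarrow> nat \<Rightarrow> real^4 \<Rightarrow> real^4 \<Rightarrow> real^4" where
  "gfam = (\<lambda>(c1, c2, c3, c4, c5, c6) i. [g1 c1, g2 c2, g3 c3, g4 c4, g5 c5, g6 c6] ! (i - 1))"

text \<open>\<^const>\<open>real_polynomial_function\<close> is inductively generated from the bounded linear
  functionals and the constants by sums and products; on a finite-dimensional space these are exactly
  the real polynomials in the coordinates.\<close>

definition zariski_open_in :: "'a::euclidean_space set \<Rightarrow> 'a set \<Rightarrow> bool" where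
  "zariski_open_in P W \<longleftrightarrow>
     (\<exists>F. finite F \<and> (\<forall>p\<in>F. real_polynomial_function p) \<and> W = {c \<in> P. \<exists>p\<in>F. p c \<noteq> 0})"

lemma engel_bracket_basis:
  "engel_bracket b14 b23 b24 b34 (ybas 1) (ybas 2) = ybas 3"
  "engel_bracket b14 b23 b24 b34 (ybas 1) (ybas 3) = ybas 4"
  "engel_bracket b14 b23 b24 b34 (ybas 1) (ybas 4) = b14"
  "engel_bracket b14 b23 b24 b34 (ybas 2) (ybas 3) = b23"
  "engel_bracket b14 b23 b24 b34 (ybas 2) (ybas 4) = b24"
  "engel_bracket b14 b23 b24 b34 (ybas 3) (ybas 4) = b34"
  by (simp_all add: engel_bracket_def axis_def)

lemma linear_engel_bracket:
  "linear (\<lambda>z. engel_bracket b14 b23 b24 b34 x z)"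
  "linear (\<lambda>x. engel_bracket b14 b23 b24 b34 x z)"
  by (rule linearI; simp add: engel_bracket_def algebra_simps)+

lemma engel_bracket_self: "engel_bracket b14 b23 b24 b34 x x = 0"
  by (simp add: engel_bracket_def)

lemma engel_bracket_swap: "engel_bracket b14 b23 b24 b34 x z = - engel_bracket b14 b23 b24 b34 z x"
  by (simp add: engel_bracket_def algebra_simps)

lemma lie_algebra_engel_bracketI:
  fixes b14 b23 b24 b34
  defines "B \<equiv> engel_bracket b14 b23 b24 b34"
  defines "J \<equiv> (\<lambda>x z w. B x (B z w) + B z (B w x) + B w (B x z))"
  assumes J: "J (ybas 1) (ybas 2) (ybas 3) = 0" "J (ybas 1) (ybas 2) (ybas 4) = 0"
    "J (ybas 1) (ybas 3) (ybas 4) = 0" "J (ybas 2) (ybas 3) (ybas 4) = 0"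
  shows "lie_algebra B"
proof -
  have lin: "linear (B x)" "linear (\<lambda>x. B x z)" for x z
    unfolding B_def by (rule linear_engel_bracket)+
  have self: "B x x = 0" and swap: "B x z = - B z x" for x z
    unfolding B_def by (rule engel_bracket_self engel_bracket_swap)+
  have neg: "B x (- z) = - B x z" "B x 0 = 0" for x z
    by (simp_all add: linear_neg[OF lin(1)] linear_0[OF lin(1)])
  have rot: "J x z w = J z w x" for x z w
    by (simp add: J_def)
  have swp: "J x z w = - J z x w" for x z w
    unfolding J_def using swap[of z w] swap[of w x] swap[of x z] by (simp add: neg)
  have J0: "J x x w = 0" for x w
    unfolding J_def using swap[of x w] by (simp add: self neg)
  have J0': "J x w x = 0" "J w x x = 0" for x w
    using J0 rot by metis+
  have perm: "J x w z = 0" "J z x w = 0" "J z w x = 0" "J w x z = 0" "J w z x = 0" if "J x z w = 0" for x z w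
    using that rot swp by (metis neg_equal_0_iff_equal)+
  have "\<forall>i j k. J (ybas i) (ybas j) (ybas k) = 0"
    unfolding forall_4 by (simp add: J J0 J0' perm[OF J(1)] perm[OF J(2)] perm[OF J(3)] perm[OF J(4)])
  then have basis: "J (ybas i) (ybas j) (ybas k) = 0" for i j k
    by blast
  have linJ: "linear (\<lambda>x. J x z w)" for z w
    unfolding J_def
    by (intro linear_compose_add lin linear_compose[OF lin(1) lin(1), unfolded o_def]
        linear_compose[OF lin(2) lin(1), unfolded o_def])
  have zero: "f = (\<lambda>_. 0)" if "linear f" "\<And>i. f (ybas i) = 0" for f :: "real^4 \<Rightarrow> real^4"
    by (rule linear_eq_stdbasis[OF that(1) linear_zero]) (use that(2) in \<open>auto simp: Basis_vec_def\<close>)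
  have 1: "J x (ybas j) (ybas k) = 0" for x j k
    using zero[OF linJ basis] by metis
  have 2: "J x z (ybas k) = 0" for x z k
    using zero[OF linJ, of "ybas k" x] 1 rot by metis
  have "J x z w = 0" for x z w
    using zero[OF linJ, of x z] 2 rot by metis
  then show ?thesis
    unfolding lie_algebra_def J_def using lin self by blast
qed

lemma engel_bracket_basis_left:
  "engel_bracket b14 b23 b24 b34 (ybas 1) v = v$2 *\<^sub>R ybas 3 + v$3 *\<^sub>R ybas 4 + v$4 *\<^sub>R b14"
  "engel_bracket b14 b23 b24 b34 (ybas 2) v = - v$1 *\<^sub>R ybas 3 + v$3 *\<^sub>R b23 + v$4 *\<^sub>R b24"
  "engel_bracket b14 b23 b24 b34 (ybas 3) v = - v$1 *\<^sub>R ybas 4 - v$2 *\<^sub>R b23 + v$4 *\<^sub>R b34"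
  "engel_bracket b14 b23 b24 b34 (ybas 4) v = - v$1 *\<^sub>R b14 - v$2 *\<^sub>R b24 - v$3 *\<^sub>R b34"
  by (simp_all add: engel_bracket_def axis_def)

lemma ybas_nth: "ybas i $ j = (if i = j then 1 else 0)"
  by (simp add: axis_def)

lemma lie_algebra_engel_bracketI':
  fixes b14 b23 b24 b34
  assumes
    "b23$2 *\<^sub>R ybas 3 + b23$3 *\<^sub>R ybas 4 + b23$4 *\<^sub>R b14 = b24"
    "b24$2 *\<^sub>R ybas 3 + b24$3 *\<^sub>R ybas 4 + b24$4 *\<^sub>R b14
       = - b14$1 *\<^sub>R ybas 3 + b14$3 *\<^sub>R b23 + b14$4 *\<^sub>R b24 + b34"
    "b34$2 *\<^sub>R ybas 3 + b34$3 *\<^sub>R ybas 4 + b34$4 *\<^sub>R b14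
       = - b14$1 *\<^sub>R ybas 4 - b14$2 *\<^sub>R b23 + b14$4 *\<^sub>R b34"
    "- b34$1 *\<^sub>R ybas 3 + b34$3 *\<^sub>R b23 + b34$4 *\<^sub>R b24
       + (b24$1 *\<^sub>R ybas 4 + b24$2 *\<^sub>R b23 - b24$4 *\<^sub>R b34)
       + (- b23$1 *\<^sub>R b14 - b23$2 *\<^sub>R b24 - b23$3 *\<^sub>R b34) = 0"
  shows "lie_algebra (engel_bracket b14 b23 b24 b34)"
  by (rule lie_algebra_engel_bracketI; use assms in \<open>simp add: engel_bracket_basis_left ybas_nth\<close>)

lemma lie_algebra_g1: "lie_algebra (g1 c)"
  by (cases c; simp add: g1_def del: axis_eq_0_iff)
    (rule lie_algebra_engel_bracketI';
      simp add: vec_eq_iff forall_4 ybas_nth; simp add: field_simps power2_eq_square power3_eq_cube)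

lemma lie_algebra_g2: "c \<in> P2 \<Longrightarrow> lie_algebra (g2 c)"
  by (cases c; simp add: g2_def P2_def Let_def del: axis_eq_0_iff)
    (rule lie_algebra_engel_bracketI';
      simp add: vec_eq_iff forall_4 ybas_nth; simp add: field_simps power2_eq_square power3_eq_cube)

lemma lie_algebra_g3: "c \<in> P3 \<Longrightarrow> lie_algebra (g3 c)"
  by (cases c; simp add: g3_def P3_def Let_def del: axis_eq_0_iff)
    (rule lie_algebra_engel_bracketI';
      simp add: vec_eq_iff forall_4 ybas_nth; simp add: field_simps power2_eq_square power3_eq_cube)

lemma lie_algebra_g4: "lie_algebra (g4 c)"
  by (cases c; simp add: g4_def del: axis_eq_0_iff)
    (rule lie_algebra_engel_bracketI';
      simp add: vec_eq_iff forall_4 ybas_nth; simp add: field_simps power2_eq_square power3_eq_cube)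

lemma lie_algebra_g5: "lie_algebra (g5 c)"
  by (cases c; simp add: g5_def del: axis_eq_0_iff)
    (rule lie_algebra_engel_bracketI';
      simp add: vec_eq_iff forall_4 ybas_nth; simp add: field_simps power2_eq_square power3_eq_cube)

lemma lie_algebra_g6: "lie_algebra (g6 c)"
  by (cases c; simp add: g6_def del: axis_eq_0_iff)
    (rule lie_algebra_engel_bracketI';
      simp add: vec_eq_iff forall_4 ybas_nth; simp add: field_simps power2_eq_square power3_eq_cube)

end

theory Submission
  imports Defs
begin

text \<open>
  Two functions on a Lie algebra are preserved by every isomorphism: the linear form
  \<open>\<tau> x = tr (ad x)\<close> and the quadratic form \<open>K x = tr ((ad x)\<^sup>2)\<close> of the Killing form. For
  generic parameters this pair alone tells the six types apart.

  Types 2, 3 and 4 have a nilpotent ideal of codimension one: it is spanned by \<open>y3\<close>, \<open>y4\<close> and,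
  respectively, \<open>(a s - 2 t) y1 + a y2\<close>, \<open>t y1 - a y2\<close> and \<open>y1\<close>. Both \<open>\<tau>\<close> and \<open>K\<close> come from
  the quotient line, so \<open>K = \<rho> \<tau>\<^sup>2\<close> as soon as \<open>\<tau> \<noteq> 0\<close>, and then the number \<open>\<rho>\<close> is an
  invariant. It is \<open>1 + 2 b / a\<^sup>2\<close> for types 2 and 3, with \<open>b\<close> and \<open>a\<close> the coefficients of
  \<open>y3\<close> and \<open>y4\<close> in \<open>[y1,y4]\<close>, and \<open>(t\<^sup>2 - d) / (2 t\<^sup>2)\<close> for type 4, with \<open>d\<close> and \<open>t\<close> the
  coefficients of \<open>y1\<close> and \<open>y3\<close> in \<open>[y2,y3]\<close>. The parameters of different types are
  independent, so these three values are generically distinct.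

  Type 5 also has an abelian ideal of codimension one, so that \<open>K\<close> has rank at most one, but it is
  unimodular, that is, \<open>\<tau> = 0\<close>. Type 6 is unimodular too, but there \<open>K\<close> has rank at least two,
  and type 1 is not unimodular with \<open>K\<close> of rank two. Hence unimodularity and the rank of \<open>K\<close>
  separate the groups \<open>{1}\<close>, \<open>{2,3,4}\<close>, \<open>{5}\<close> and \<open>{6}\<close> (\<open>g1_class\<close> to \<open>g6_class\<close>),
  and \<open>\<rho>\<close> separates the members of the second one. Every condition used is the nonvanishing of
  a polynomial; the open set is the nonvanishing locus of their product, \<open>genericity\<close>.
\<close>

section \<open>The trace form and the Killing form\<close>

definition ad_trace :: "(real^'n \<Rightarrow> real^'n \<Rightarrow> real^'n) \<Rightarrow> real^'n \<Rightarrow> real" where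
  "ad_trace B x = trace (matrix (B x))"

definition killing_quad :: "(real^'n \<Rightarrow> real^'n \<Rightarrow> real^'n) \<Rightarrow> real^'n \<Rightarrow> real" where
  "killing_quad B x = trace (matrix (B x) ** matrix (B x))"

definition unimodular :: "(real^'n \<Rightarrow> real^'n \<Rightarrow> real^'n) \<Rightarrow> bool" where
  "unimodular B \<longleftrightarrow> (\<forall>x. ad_trace B x = 0)"

text \<open>
  The difference on the left is twice the value of the Killing form at \<open>(x, z)\<close>, so the equation
  says that the Gram determinant of \<open>x\<close> and \<open>z\<close> vanishes. A real symmetric form has rank at most
  one exactly if all these determinants vanish.
\<close>
definition killing_rank_le_1 :: "(real^'n \<Rightarrow> real^'n \<Rightarrow> real^'n) \<Rightarrow> bool" where
  "killing_rank_le_1 B \<longleftrightarrow> (\<forall>x z.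
     (killing_quad B (x + z) - killing_quad B x - killing_quad B z)\<^sup>2 =
     4 * killing_quad B x * killing_quad B z)"

definition killing_ratio :: "real \<Rightarrow> (real^'n \<Rightarrow> real^'n \<Rightarrow> real^'n) \<Rightarrow> bool" where
  "killing_ratio \<rho> B \<longleftrightarrow> (\<forall>x. killing_quad B x = \<rho> * (ad_trace B x)\<^sup>2)"

section \<open>Invariance under isomorphisms\<close>

lemma trace_eq_of_similar:
  fixes F M N :: "real^'n^'n"
  assumes "invertible F" and "F ** M = N ** F"
  shows "trace M = trace N"
proof -
  obtain G where G: "F ** G = mat 1" "G ** F = mat 1"
    using assms(1) by (auto simp: invertible_def)
  have "trace M = trace (G ** (F ** M))"
    by (simp add: matrix_mul_assoc G)
  also have "\<dots> = trace ((N ** F) ** G)"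
    unfolding assms(2) by (rule trace_mul_sym)
  also have "\<dots> = trace N"
    by (simp add: matrix_mul_assoc[symmetric] G)
  finally show ?thesis .
qed

text \<open>
  An isomorphism \<open>f\<close> intertwines \<open>ad x\<close> with \<open>ad (f x)\<close>, hence also their squares; similar
  matrices have the same trace.
\<close>
lemma lie_isomorphic_invariants:
  fixes B B' :: "real^'n \<Rightarrow> real^'n \<Rightarrow> real^'n"
  assumes "lie_algebra B" and "lie_algebra B'" and "lie_isomorphic B B'"
  obtains f where "linear f" "surj f"
    "\<And>x. ad_trace B' (f x) = ad_trace B x" "\<And>x. killing_quad B' (f x) = killing_quad B x"
proof -
  obtain f where f: "linear f" "bij f" and hom: "\<And>x z. f (B x z) = B' (f x) (f z)"
    using assms(3) unfolding lie_isomorphic_def by blast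
  have lin: "linear (B x)" "linear (B' x)" for x
    using assms(1,2) by (auto simp: lie_algebra_def)
  have inv: "invertible (matrix f)"
    using f by (simp add: bij_is_inj invertible_left_inverse matrix_left_invertible_injective)
  have comm: "matrix f ** matrix (B x) = matrix (B' (f x)) ** matrix f" for x
    by (simp add: matrix_compose[symmetric] f lin hom o_def)
  have "matrix f ** (matrix (B x) ** matrix (B x)) =
      (matrix (B' (f x)) ** matrix (B' (f x))) ** matrix f" for x
    by (metis comm matrix_mul_assoc)
  then have "killing_quad B' (f x) = killing_quad B x" for x
    unfolding killing_quad_def using trace_eq_of_similar[OF inv] by metis
  moreover have "ad_trace B' (f x) = ad_trace B x" for x
    unfolding ad_trace_def using trace_eq_of_similar[OF inv comm] by metis
  ultimately show thesis
    using that[of f] f bij_is_surj by blast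
qed

lemma lie_isomorphic_invariant_properties:
  fixes B B' :: "real^'n \<Rightarrow> real^'n \<Rightarrow> real^'n"
  assumes "lie_algebra B" and "lie_algebra B'" and "lie_isomorphic B B'"
  shows "unimodular B' \<longleftrightarrow> unimodular B"
    and "killing_rank_le_1 B' \<longleftrightarrow> killing_rank_le_1 B"
    and "killing_ratio \<rho> B' \<longleftrightarrow> killing_ratio \<rho> B"
proof -
  obtain f where f: "linear f" "surj f"
    and inv: "\<And>x. ad_trace B' (f x) = ad_trace B x" "\<And>x. killing_quad B' (f x) = killing_quad B x"
    using lie_isomorphic_invariants[OF assms] by blast
  have all: "(\<forall>y. Q y) \<longleftrightarrow> (\<forall>x. Q (f x))" for Q :: "real^'n \<Rightarrow> bool"
    using f(2) by (metis surj_def)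
  show "unimodular B' \<longleftrightarrow> unimodular B"
    unfolding unimodular_def by (subst all) (simp add: inv)
  show "killing_rank_le_1 B' \<longleftrightarrow> killing_rank_le_1 B"
    unfolding killing_rank_le_1_def
    by (subst all, subst (2) all) (simp add: inv linear_add[OF f(1), symmetric])
  show "killing_ratio \<rho> B' \<longleftrightarrow> killing_ratio \<rho> B"
    unfolding killing_ratio_def by (subst all) (simp add: inv)
qed

section \<open>Criteria for the rank and the ratio\<close>

lemma ad_trace_add:
  assumes "lie_algebra B"
  shows "ad_trace B (x + z) = ad_trace B x + ad_trace B z"
proof -
  have "B (x + z) w = B x w + B z w" for w
    using assms linear_add[of "\<lambda>x. B x w"] by (auto simp: lie_algebra_def)
  then show ?thesis
    by (simp add: ad_trace_def trace_def matrix_def sum.distrib)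
qed

lemma killing_rank_le_1_if_square:
  assumes "\<And>x. killing_quad B x = \<rho> * (\<phi> x)\<^sup>2" and "\<And>x z. \<phi> (x + z) = \<phi> x + \<phi> z"
  shows "killing_rank_le_1 B"
  unfolding killing_rank_le_1_def assms by (simp add: algebra_simps power2_eq_square)

lemma killing_rank_le_1_if_ratio:
  assumes "lie_algebra B" and "killing_ratio \<rho> B"
  shows "killing_rank_le_1 B"
  using assms killing_rank_le_1_if_square[of B \<rho> "ad_trace B"]
  by (simp add: killing_ratio_def ad_trace_add)

lemma killing_ratio_unique:
  assumes "killing_ratio \<rho> B" and "killing_ratio \<sigma> B" and "\<not> unimodular B"
  shows "\<rho> = \<sigma>"
  using assms unfolding killing_ratio_def unimodular_def by (metis mult_right_cancel power_not_zero)

lemma not_killing_rank_le_1: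
  assumes "(killing_quad B (x + z) - killing_quad B x - killing_quad B z)\<^sup>2 \<noteq>
     4 * killing_quad B x * killing_quad B z"
  shows "\<not> killing_rank_le_1 B"
  using assms unfolding killing_rank_le_1_def by blast

section \<open>The invariants of the six types\<close>

lemmas trace_coords = ad_trace_def killing_quad_def trace_def matrix_def matrix_matrix_mult_def
  sum_4 engel_bracket_def ybas_nth

text \<open>
  The vector \<open>y2 - s y1\<close> acts on the ideal spanned by \<open>y3\<close> and \<open>y4\<close> as the scalar
  \<open>t - a s\<close>, and \<open>y1\<close> acts on it with trace \<open>a\<close> and determinant \<open>- b\<close>; both act trivially
  on the quotient. This gives all four values.
\<close>
lemma g1_traces:
  "ad_trace (g1 (b,a,s,t)) (ybas 2 - s *\<^sub>R ybas 1) = 2 * (t - a * s)"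
  "killing_quad (g1 (b,a,s,t)) (ybas 1) = a\<^sup>2 + 2 * b"
  "killing_quad (g1 (b,a,s,t)) (ybas 2 - s *\<^sub>R ybas 1) = 2 * (t - a * s)\<^sup>2"
  "killing_quad (g1 (b,a,s,t)) (ybas 1 + (ybas 2 - s *\<^sub>R ybas 1)) =
     a\<^sup>2 + 2 * b + 2 * a * (t - a * s) + 2 * (t - a * s)\<^sup>2"
  by (simp add: g1_def trace_coords; simp add: algebra_simps power2_eq_square)+

lemma g2_ad_trace: "a \<noteq> 0 \<Longrightarrow> ad_trace (g2 (b,a,s,t)) x = a * x$1 + (2 * t - a * s) * x$2"
  by (simp add: g2_def Let_def trace_coords; simp add: field_simps power2_eq_square power3_eq_cube)

text \<open>
  With \<open>w = (a s - 2 t) y1 + a y2\<close>, all brackets of \<open>w\<close>, \<open>y3\<close>, \<open>y4\<close> are multiples of one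
  vector, which commutes with these three. So they span a nilpotent ideal, which lies in the kernel
  of both forms, and the factor is found by evaluating at \<open>y1\<close>.
\<close>
lemma g2_killing_quad:
  "a \<noteq> 0 \<Longrightarrow> killing_quad (g2 (b,a,s,t)) x =
     (a\<^sup>2 + 2 * b) / a\<^sup>2 * (ad_trace (g2 (b,a,s,t)) x)\<^sup>2"
  unfolding g2_ad_trace
  by (simp add: g2_def Let_def trace_coords; simp add: field_simps power2_eq_square power3_eq_cube)

lemma g3_ad_trace: "a \<noteq> 0 \<Longrightarrow> ad_trace (g3 (c,b,a,t)) x = a * x$1 + t * x$2"
  by (simp add: g3_def trace_coords; simp add: field_simps power2_eq_square)

text \<open>
  Here \<open>t y1 - a y2\<close>, \<open>y3\<close>, \<open>y4\<close> span an abelian ideal, on which \<open>y1\<close> acts with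
  characteristic polynomial \<open>X\<^sup>3 - a X\<^sup>2 - b X - c\<close>: the power sums of its roots are \<open>a\<close> and
  \<open>a\<^sup>2 + 2 b\<close>.
\<close>
lemma g3_killing_quad:
  "a \<noteq> 0 \<Longrightarrow> killing_quad (g3 (c,b,a,t)) x =
     (a\<^sup>2 + 2 * b) / a\<^sup>2 * (ad_trace (g3 (c,b,a,t)) x)\<^sup>2"
  unfolding g3_ad_trace
  by (simp add: g3_def trace_coords; simp add: field_simps power2_eq_square power4_eq_xxxx)

text \<open>
  The ideal spanned by \<open>y1\<close>, \<open>y3\<close> and its central element \<open>y4\<close> is a Heisenberg algebra. On
  the line of \<open>y4\<close> the vector \<open>y2\<close> acts as \<open>t\<close>, and modulo \<open>y4\<close> it acts on \<open>y1\<close>, \<open>y3\<close>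
  with trace \<open>t\<close> and determinant \<open>d\<close>.
\<close>
lemma g4_traces:
  "ad_trace (g4 (d,s,t)) x = 2 * t * x$2"
  "killing_quad (g4 (d,s,t)) x = 2 * (t\<^sup>2 - d) * (x$2)\<^sup>2"
  by (simp add: g4_def trace_coords; simp add: algebra_simps power2_eq_square)+

text \<open>
  The abelian ideal is spanned by \<open>y2 - s y1\<close>, \<open>y3\<close>, \<open>y4\<close>, and \<open>y1\<close> acts on it with
  characteristic polynomial \<open>X\<^sup>3 - b X - c\<close>. The linear form \<open>x1 + s x2\<close> is the coordinate on
  the quotient.
\<close>
lemma g5_traces:
  "ad_trace (g5 (c,b,s)) x = 0"
  "killing_quad (g5 (c,b,s)) x = 2 * b * (x$1 + s * x$2)\<^sup>2"
  by (simp add: g5_def trace_coords; simp add: algebra_simps power2_eq_square)+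

text \<open>
  The last three values say that \<open>y1\<close> and \<open>y3\<close> are orthogonal for the Killing form, which makes
  them a convenient test of its rank.
\<close>
lemma g6_traces:
  "ad_trace (g6 (b,d,s,e)) x = 0"
  "killing_quad (g6 (b,d,s,e)) (ybas 1) = 2 * b"
  "killing_quad (g6 (b,d,s,e)) (ybas 3) = 2 * (e\<^sup>2 + b * d + b * e * s)"
  "killing_quad (g6 (b,d,s,e)) (ybas 1 + ybas 3) = 2 * b + 2 * (e\<^sup>2 + b * d + b * e * s)"
  by (simp add: g6_def trace_coords; simp add: algebra_simps power2_eq_square)+

lemma g1_class:
  assumes "t - a * s \<noteq> 0" and "a\<^sup>2 + 4 * b \<noteq> 0"
  shows "\<not> unimodular (g1 (b,a,s,t))" and "\<not> killing_rank_le_1 (g1 (b,a,s,t))"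
proof -
  show "\<not> unimodular (g1 (b,a,s,t))"
    using g1_traces(1)[of b a s t] assms(1)
    unfolding unimodular_def by (metis mult_eq_0_iff zero_neq_numeral)
  let ?l = "t - a * s"
  \<comment> \<open>Up to a factor, this is the Gram determinant of \<open>y1\<close> and \<open>y2 - s y1\<close>.\<close>
  have "(2 * a * ?l)\<^sup>2 - 4 * (a\<^sup>2 + 2 * b) * (2 * ?l\<^sup>2) = - 4 * ?l\<^sup>2 * (a\<^sup>2 + 4 * b)"
    by (simp add: algebra_simps power2_eq_square)
  also have "\<dots> \<noteq> 0"
    using assms by simp
  finally show "\<not> killing_rank_le_1 (g1 (b,a,s,t))"
    by (intro not_killing_rank_le_1[of _ "ybas 1" "ybas 2 - s *\<^sub>R ybas 1"])
      (simp only: g1_traces, simp)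
qed

lemma g2_class:
  assumes "a \<noteq> 0"
  shows "\<not> unimodular (g2 (b,a,s,t))" and "killing_ratio ((a\<^sup>2 + 2 * b) / a\<^sup>2) (g2 (b,a,s,t))"
proof -
  have "ad_trace (g2 (b,a,s,t)) (ybas 1) = a"
    by (simp add: g2_ad_trace assms ybas_nth)
  then show "\<not> unimodular (g2 (b,a,s,t))"
    using assms unfolding unimodular_def by metis
qed (simp add: killing_ratio_def g2_killing_quad[OF assms])

lemma g3_class:
  assumes "a \<noteq> 0"
  shows "\<not> unimodular (g3 (c,b,a,t))" and "killing_ratio ((a\<^sup>2 + 2 * b) / a\<^sup>2) (g3 (c,b,a,t))"
proof -
  have "ad_trace (g3 (c,b,a,t)) (ybas 1) = a"
    by (simp add: g3_ad_trace assms ybas_nth)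
  then show "\<not> unimodular (g3 (c,b,a,t))"
    using assms unfolding unimodular_def by metis
qed (simp add: killing_ratio_def g3_killing_quad[OF assms])

lemma g4_class:
  assumes "t \<noteq> 0"
  shows "\<not> unimodular (g4 (d,s,t))" and "killing_ratio ((t\<^sup>2 - d) / (2 * t\<^sup>2)) (g4 (d,s,t))"
proof -
  have "ad_trace (g4 (d,s,t)) (ybas 2) = 2 * t"
    by (simp add: g4_traces ybas_nth)
  then show "\<not> unimodular (g4 (d,s,t))"
    using assms unfolding unimodular_def by (metis mult_eq_0_iff zero_neq_numeral)
qed (use assms in \<open>simp add: killing_ratio_def g4_traces power_mult_distrib\<close>)

lemma g5_class: "unimodular (g5 (c,b,s))" "killing_rank_le_1 (g5 (c,b,s))"
  by (simp add: unimodular_def g5_traces)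
    (rule killing_rank_le_1_if_square[OF g5_traces(2)], simp add: algebra_simps)

lemma g6_class:
  assumes "b \<noteq> 0" and "e\<^sup>2 + b * d + b * e * s \<noteq> 0"
  shows "unimodular (g6 (b,d,s,e))" and "\<not> killing_rank_le_1 (g6 (b,d,s,e))"
  by (simp add: unimodular_def g6_traces)
    (rule not_killing_rank_le_1[of _ "ybas 1" "ybas 3"], use assms in \<open>simp add: g6_traces\<close>)

section \<open>Generic parameters\<close>

text \<open>
  The first two factors are the hypotheses of \<open>g1_class\<close>, the last two those of
  \<open>g6_class\<close>, and \<open>t4\<close> is that of \<open>g4_class\<close>. The other three are, up to constants, the
  numerators of \<open>\<rho>2 - \<rho>3\<close>, \<open>\<rho>2 - \<rho>4\<close> and \<open>\<rho>3 - \<rho>4\<close>, where \<open>\<rho>i\<close> is the ratio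
  \<open>K / \<tau>\<^sup>2\<close> of type \<open>i\<close>.
\<close>
definition genericity ::
  "real4 \<times> real4 \<times> real4 \<times> real3 \<times> real3 \<times> real4 \<Rightarrow> real" where
  "genericity = (\<lambda>((b1,a1,s1,t1), (b2,a2,s2,t2), (c3,b3,a3,t3), (d4,s4,t4), _, (b6,d6,s6,e6)).
     (t1 - a1 * s1) * (a1\<^sup>2 + 4 * b1) * (b2 * a3\<^sup>2 - b3 * a2\<^sup>2) * t4 *
     ((a2\<^sup>2 + 2 * b2) * (2 * t4\<^sup>2) - (t4\<^sup>2 - d4) * a2\<^sup>2) *
     ((a3\<^sup>2 + 2 * b3) * (2 * t4\<^sup>2) - (t4\<^sup>2 - d4) * a3\<^sup>2) *
     b6 * (e6\<^sup>2 + b6 * d6 + b6 * e6 * s6))"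

lemma real_polynomial_function_genericity: "real_polynomial_function genericity"
  unfolding genericity_def case_prod_unfold
  by (intro real_polynomial_function.intros(2-) real_polynomial_function_diff
      real_polynomial_function_power real_polynomial_function.intros(1) bounded_linear_intros)

lemma gfam_not_isomorphic:
  assumes c: "c \<in> P1 \<times> P2 \<times> P3 \<times> P4 \<times> P5 \<times> P6" and gen: "genericity c \<noteq> 0"
    and ij: "1 \<le> i" "i < j" "j \<le> 6"
  shows "\<not> lie_isomorphic (gfam c i) (gfam c j)"
proof
  assume iso: "lie_isomorphic (gfam c i) (gfam c j)"
  obtain b1 a1 s1 t1 b2 a2 s2 t2 c3 b3 a3 t3 d4 s4 t4 c5 b5 s5 b6 d6 s6 e6 where
    c_eq: "c = ((b1,a1,s1,t1), (b2,a2,s2,t2), (c3,b3,a3,t3), (d4,s4,t4), (c5,b5,s5), (b6,d6,s6,e6))"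
    by (metis prod.exhaust)
  have a: "a2 \<noteq> 0" "a3 \<noteq> 0"
    using c by (auto simp: c_eq P2_def P3_def)
  have nz: "t1 - a1 * s1 \<noteq> 0" "a1\<^sup>2 + 4 * b1 \<noteq> 0" "t4 \<noteq> 0" "b6 \<noteq> 0"
      "e6\<^sup>2 + b6 * d6 + b6 * e6 * s6 \<noteq> 0"
    and ne: "b2 * a3\<^sup>2 \<noteq> b3 * a2\<^sup>2" "(a2\<^sup>2 + 2 * b2) * (2 * t4\<^sup>2) \<noteq> (t4\<^sup>2 - d4) * a2\<^sup>2"
      "(a3\<^sup>2 + 2 * b3) * (2 * t4\<^sup>2) \<noteq> (t4\<^sup>2 - d4) * a3\<^sup>2"
    using gen unfolding c_eq genericity_def by auto
  define \<rho>2 \<rho>3 \<rho>4 where \<rho>: "\<rho>2 = (a2\<^sup>2 + 2 * b2) / a2\<^sup>2" "\<rho>3 = (a3\<^sup>2 + 2 * b3) / a3\<^sup>2"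
    "\<rho>4 = (t4\<^sup>2 - d4) / (2 * t4\<^sup>2)"
  have \<rho>_ne: "\<rho>2 \<noteq> \<rho>3" "\<rho>2 \<noteq> \<rho>4" "\<rho>3 \<noteq> \<rho>4"
    using ne a nz(3) unfolding \<rho> by (simp_all add: frac_eq_eq algebra_simps)
  let ?g = "gfam c"
  have g: "?g 1 = g1 (b1,a1,s1,t1)" "?g 2 = g2 (b2,a2,s2,t2)" "?g 3 = g3 (c3,b3,a3,t3)"
    "?g 4 = g4 (d4,s4,t4)" "?g 5 = g5 (c5,b5,s5)" "?g 6 = g6 (b6,d6,s6,e6)"
    by (simp_all add: gfam_def c_eq)
  have "lie_algebra (?g 1)" "lie_algebra (?g 2)" "lie_algebra (?g 3)"
    "lie_algebra (?g 4)" "lie_algebra (?g 5)" "lie_algebra (?g 6)"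
    unfolding g using c unfolding c_eq
    by (blast intro: lie_algebra_g1 lie_algebra_g2 lie_algebra_g3
        lie_algebra_g4 lie_algebra_g5 lie_algebra_g6)+
  moreover have "k \<in> {1, 2, 3, 4, 5, 6}" if "1 \<le> k" "k \<le> 6" for k :: nat
    using that by auto
  ultimately have lie: "lie_algebra (?g k)" if "1 \<le> k" "k \<le> 6" for k
    using that by blast
  have ratio: "killing_ratio \<rho>2 (?g 2)" "killing_ratio \<rho>3 (?g 3)" "killing_ratio \<rho>4 (?g 4)"
    unfolding g \<rho> using a nz(3) by (auto intro: g2_class g3_class g4_class)
  have unimod: "\<not> unimodular (?g 1)" "\<not> unimodular (?g 2)" "\<not> unimodular (?g 3)"
    "\<not> unimodular (?g 4)" "unimodular (?g 5)" "unimodular (?g 6)"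
    unfolding g using g1_class(1)[OF nz(1,2)] g2_class(1)[OF a(1)] g3_class(1)[OF a(2)]
      g4_class(1)[OF nz(3)] g5_class(1) g6_class(1)[OF nz(4,5)] by blast+
  have rank: "\<not> killing_rank_le_1 (?g 1)" "killing_rank_le_1 (?g 5)" "\<not> killing_rank_le_1 (?g 6)"
    unfolding g using g1_class(2)[OF nz(1,2)] g5_class(2) g6_class(2)[OF nz(4,5)] by blast+
  have rank': "killing_rank_le_1 (?g 2)" "killing_rank_le_1 (?g 3)" "killing_rank_le_1 (?g 4)"
    by (rule killing_rank_le_1_if_ratio[OF lie ratio(1)] killing_rank_le_1_if_ratio[OF lie ratio(2)]
        killing_rank_le_1_if_ratio[OF lie ratio(3)]; simp)+
  have eq_ratio: "\<sigma> = \<rho>"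
    if "killing_ratio \<rho> (?g i)" "killing_ratio \<sigma> (?g j)" "\<not> unimodular (?g j)" for \<rho> \<sigma>
    using that killing_ratio_unique lie_isomorphic_invariant_properties(3)[OF _ _ iso] lie ij
    by (metis less_imp_le order_trans)
  have inv: "unimodular (?g j) = unimodular (?g i)"
    "killing_rank_le_1 (?g j) = killing_rank_le_1 (?g i)"
    using lie_isomorphic_invariant_properties(1,2)[OF lie lie iso] ij by simp_all
  have not23: "\<not> (i = 2 \<and> j = 3)"
    using eq_ratio[of \<rho>2 \<rho>3] ratio(1,2) unimod(3) \<rho>_ne(1) by metis
  have not24: "\<not> (i = 2 \<and> j = 4)"
    using eq_ratio[of \<rho>2 \<rho>4] ratio(1,3) unimod(4) \<rho>_ne(2) by metis
  have not34: "\<not> (i = 3 \<and> j = 4)"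
    using eq_ratio[of \<rho>3 \<rho>4] ratio(2,3) unimod(4) \<rho>_ne(3) by metis
  have "i = 1 \<or> i = 2 \<or> i = 3 \<or> i = 4 \<or> i = 5" "j = 2 \<or> j = 3 \<or> j = 4 \<or> j = 5 \<or> j = 6"
    using ij by linarith+
  then show False
    using ij not23 not24 not34 inv unimod rank rank'
    by (elim disjE; simp only: simp_thms; simp)
qed

theorem theorem4p1:
  shows "\<exists>W. zariski_open_in (P1 \<times> P2 \<times> P3 \<times> P4 \<times> P5 \<times> P6) W \<and> W \<noteq> {} \<and>
    (\<forall>c\<in>W. \<forall>i j. 1 \<le> i \<and> i < j \<and> j \<le> 6 \<longrightarrow> \<not> lie_isomorphic (gfam c i) (gfam c j))"
proof (intro exI conjI)
  let ?P = "P1 \<times> P2 \<times> P3 \<times> P4 \<times> P5 \<times> P6"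
  let ?W = "{c \<in> ?P. genericity c \<noteq> 0}"
  show "zariski_open_in ?P ?W"
    unfolding zariski_open_in_def
    by (rule exI[of _ "{genericity}"]) (simp add: real_polynomial_function_genericity)
  \<comment> \<open>At this point the ratios of types 2, 3 and 4 are \<open>1\<close>, \<open>3\<close> and \<open>1/2\<close>.\<close>
  have "((1,0,0,1), (0,1,0,0), (0,1,1,0), (0,0,1), (0,0,0), (1,0,0,1)) \<in> ?W"
    by (simp add: P1_def P2_def P3_def P4_def P5_def P6_def genericity_def)
  then show "?W \<noteq> {}"
    by blast
  show "\<forall>c\<in>?W. \<forall>i j. 1 \<le> i \<and> i < j \<and> j \<le> 6 \<longrightarrow> \<not> lie_isomorphic (gfam c i) (gfam c j)"
    using gfam_not_isomorphic by blast
qed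

end
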